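(* Let $X$ be a set, $E$ a set of parameters, and let $\{\Sigma_e : e\in E\}$ be a family of crisp topologies on $X$ indexed by $E$. Then $$T\Big(\bigcup_{e\in E}\hat{\mathcal{T}}(\Sigma_e)\Big)=\hat{\mathcal{T}}\Big(T\Big(\bigcup_{e\in E}\Sigma_e\Big)\Big),$$ where on the left $T(\cdot)$ denotes the soft topology on $X$ generated by a collection of soft sets, and on the right $T(\cdot)$ denotes the crisp topology on $X$ generated by a collection of subsets of $X$.
   Context: A "crisp" topology is an ordinary topology. A soft set over $X$ (with parameter set $E$) is $(F,E)=\{(e,F(e)) : e\in E\}$ where $F:E\to\mathcal{P}(X)$ is a map; $S_E(X)$ is the family of all soft sets. Unions and intersections of soft sets are taken parameterwise. The null soft set $\widetilde{\Phi}$ has $F(e)=\emptyset$ for all $e$; the absolute soft set $\widetilde{X}$ has $F(e)=X$ for all $e$. A soft topology on $X$ is a collection $\Sigma\subseteq S_E(X)$ containing $\widetilde{\Phi}$ and $\widetilde{X}$, closed under pairwise (parameterwise) intersections and arbitrary (parameterwise) unions. For $\mathcal{F}\subseteq S_E(X)$, $T(\mathcal{F})$ is the intersection of all soft topologies on $X$ that include $\mathcal{F}$ (the soft topology generated by $\mathcal{F}$). Likewise, for a family $\mathcal{A}$ of subsets of $X$, $T(\mathcal{A})$ is the intersection of all topologies on $X$ that include $\mathcal{A}$. For a crisp topology $\sigma$ on $X$, the single set soft topology generated by $\sigma$ is $\hat{\mathcal{T}}(\sigma)=\{(F,E)\in S_E(X) : \text{there is } U\in\sigma \text{ with } F(e)=U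 \text{ for all } e\in E\}$. *)

theory Defs
  imports "HOL-Library.FuncSet" "HOL-Analysis.Abstract_Topology"
begin

text \<open>
  A soft set \<open>{(e, F e) | e. e \<in> E}\<close> over \<open>X\<close> is represented by the map \<open>F\<close> itself, taken
  extensional on \<open>E\<close>, so that equality of soft sets is equality of functions.
\<close>

type_synonym ('e, 'a) soft_set = "'e \<Rightarrow> 'a set"

definition soft_sets :: "'a set \<Rightarrow> 'e set \<Rightarrow> ('e, 'a) soft_set set" where
  "soft_sets X E = (E \<rightarrow>\<^sub>E Pow X)"

definition null_soft :: "'e set \<Rightarrow> ('e, 'a) soft_set" where
  "null_soft E = (\<lambda>e\<in>E. {})"

definition absolute_soft :: "'a set \<Rightarrow> 'e set \<Rightarrow> ('e, 'a) soft_set" where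
  "absolute_soft X E = (\<lambda>e\<in>E. X)"

definition soft_Int :: "'e set \<Rightarrow> ('e, 'a) soft_set \<Rightarrow> ('e, 'a) soft_set \<Rightarrow> ('e, 'a) soft_set" where
  "soft_Int E F G = (\<lambda>e\<in>E. F e \<inter> G e)"

definition soft_Union :: "'e set \<Rightarrow> ('e, 'a) soft_set set \<Rightarrow> ('e, 'a) soft_set" where
  "soft_Union E \<G> = (\<lambda>e\<in>E. \<Union>F\<in>\<G>. F e)"

definition soft_topology_on :: "'a set \<Rightarrow> 'e set \<Rightarrow> ('e, 'a) soft_set set \<Rightarrow> bool" where
  "soft_topology_on X E \<S> \<longleftrightarrow>
     \<S> \<subseteq> soft_sets X E \<and>
     null_soft E \<in> \<S> \<and>
     absolute_soft X E \<in> \<S> \<and>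
     (\<forall>F\<in>\<S>. \<forall>G\<in>\<S>. soft_Int E F G \<in> \<S>) \<and>
     (\<forall>\<G>. \<G> \<subseteq> \<S> \<longrightarrow> soft_Union E \<G> \<in> \<S>)"

definition soft_topology_generated ::
    "'a set \<Rightarrow> 'e set \<Rightarrow> ('e, 'a) soft_set set \<Rightarrow> ('e, 'a) soft_set set" where
  "soft_topology_generated X E \<F> = \<Inter>{\<S>. soft_topology_on X E \<S> \<and> \<F> \<subseteq> \<S>}"

text \<open>
  Crisp topologies are kept as families of open sets. The empty set is open because
  \<^const>\<open>istopology\<close> includes closure under the empty union.
\<close>

definition crisp_topology_on :: "'a set \<Rightarrow> 'a set set \<Rightarrow> bool" where
  "crisp_topology_on X \<tau> \<longleftrightarrow> \<tau> \<subseteq> Pow X \<and> X \<in> \<tau> \<and> istopology (\<lambda>U. U \<in> \<tau>)"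

text \<open>
  \<^const>\<open>topology_generated_by\<close> is not used here: its underlying set is the union of the
  generators, which need not be \<open>X\<close> (for instance when there are no generators).
\<close>

definition crisp_topology_generated :: "'a set \<Rightarrow> 'a set set \<Rightarrow> 'a set set" where
  "crisp_topology_generated X \<A> = \<Inter>{\<tau>. crisp_topology_on X \<tau> \<and> \<A> \<subseteq> \<tau>}"

definition single_set_soft_topology ::
    "'a set \<Rightarrow> 'e set \<Rightarrow> 'a set set \<Rightarrow> ('e, 'a) soft_set set" where
  "single_set_soft_topology X E \<sigma> = {F \<in> soft_sets X E. \<exists>U\<in>\<sigma>. \<forall>e\<in>E. F e = U}"

end

(* A crisp topology embeds into the soft sets through the constant maps, U being sent to (e -> U),
   and this embedding commutes with intersections and unions. So constants carry crisp topologies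
   to soft topologies, and conversely the sets whose constant map lies in a given soft topology
   form a crisp topology; each inclusion is the minimality of one generated topology tested
   against one of these. *)

theory Submission
  imports Defs
begin

text \<open>Soft sets are extensional on \<open>E\<close>, so one with the single value
  \<open>U\<close> on \<open>E\<close> is the constant map of \<open>U\<close> itself. The bound by
  \<open>Pow X\<close> ensures that these constant maps are soft sets over \<open>X\<close>.\<close>

lemma single_set_soft_topology_eq_image:
  assumes "\<sigma> \<subseteq> Pow X"
  shows "single_set_soft_topology X E \<sigma> = (\<lambda>U. \<lambda>e\<in>E. U) ` \<sigma>"
proof (intro set_eqI iffI)
  fix F assume "F \<in> single_set_soft_topology X E \<sigma>"
  then have F: "F \<in> E \<rightarrow>\<^sub>E Pow X" and "\<exists>U\<in>\<sigma>. \<forall>e\<in>E. F e = U"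
    by (simp_all add: single_set_soft_topology_def soft_sets_def)
  then obtain U where U: "U \<in> \<sigma>" "\<forall>e\<in>E. F e = U"
    by (elim bexE)
  \<comment> \<open>Outside \<open>E\<close> both sides take the default value
    \<open>undefined\<close>.\<close>
  have "F e = (\<lambda>e\<in>E. U) e" for e
    using U(2) PiE_arb[OF F] by (cases "e \<in> E") simp_all
  then have "F = (\<lambda>e\<in>E. U)"
    by (rule ext)
  with U(1) show "F \<in> (\<lambda>U. \<lambda>e\<in>E. U) ` \<sigma>"
    by blast
next
  fix F assume "F \<in> (\<lambda>U. \<lambda>e\<in>E. U) ` \<sigma>"
  then obtain U where "U \<in> \<sigma>" "F = (\<lambda>e\<in>E. U)"
    by (elim imageE)
  then show "F \<in> single_set_soft_topology X E \<sigma>"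
    using assms by (auto simp: single_set_soft_topology_def soft_sets_def)
qed

lemma single_set_soft_topology_mono:
  "\<sigma> \<subseteq> \<tau> \<Longrightarrow> single_set_soft_topology X E \<sigma> \<subseteq> single_set_soft_topology X E \<tau>"
  by (auto simp: single_set_soft_topology_def)

lemma soft_Int_const: "soft_Int E (\<lambda>e\<in>E. U) (\<lambda>e\<in>E. V) = (\<lambda>e\<in>E. U \<inter> V)"
  by (auto simp: soft_Int_def fun_eq_iff)

lemma soft_Union_const: "soft_Union E ((\<lambda>U. \<lambda>e\<in>E. U) ` \<A>) = (\<lambda>e\<in>E. \<Union>\<A>)"
  by (auto simp: soft_Union_def fun_eq_iff)

lemma crisp_topology_on_iff:
  "crisp_topology_on X \<tau> \<longleftrightarrow>
     \<tau> \<subseteq> Pow X \<and> X \<in> \<tau> \<and> (\<forall>U\<in>\<tau>. \<forall>V\<in>\<tau>. U \<inter> V \<in> \<tau>) \<and> (\<forall>\<A>. \<A> \<subseteq> \<tau> \<longrightarrow> \<Union>\<A> \<in> \<tau>)"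
  by (auto simp: crisp_topology_on_def istopology_def subset_iff)

lemma crisp_topology_on_Pow: "crisp_topology_on X (Pow X)"
  by (auto simp: crisp_topology_on_iff)

lemma crisp_topology_on_generated:
  assumes "\<A> \<subseteq> Pow X"
  shows "crisp_topology_on X (crisp_topology_generated X \<A>)"
  unfolding crisp_topology_on_iff
proof (intro conjI ballI allI impI)
  \<comment> \<open>The discrete topology \<open>Pow X\<close> is among the topologies intersected;
    an empty intersection would be the whole type instead.\<close>
  show "crisp_topology_generated X \<A> \<subseteq> Pow X"
    unfolding crisp_topology_generated_def
    by (rule Inf_lower) (simp add: assms crisp_topology_on_Pow)
  show "X \<in> crisp_topology_generated X \<A>"
    by (simp add: crisp_topology_generated_def crisp_topology_on_iff)
next
  fix U V
  assume "U \<in> crisp_topology_generated X \<A>" "V \<in> crisp_topology_generated X \<A>"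
  then show "U \<inter> V \<in> crisp_topology_generated X \<A>"
    by (simp add: crisp_topology_generated_def crisp_topology_on_iff)
next
  fix \<B> assume "\<B> \<subseteq> crisp_topology_generated X \<A>"
  then have "\<B> \<subseteq> \<tau>" if "crisp_topology_on X \<tau>" "\<A> \<subseteq> \<tau>" for \<tau>
    using that by (auto simp: crisp_topology_generated_def)
  then show "\<Union>\<B> \<in> crisp_topology_generated X \<A>"
    by (simp add: crisp_topology_generated_def crisp_topology_on_iff)
qed

lemma subset_crisp_topology_generated: "\<A> \<subseteq> crisp_topology_generated X \<A>"
  by (auto simp: crisp_topology_generated_def)

lemma crisp_topology_generated_minimal:
  "crisp_topology_on X \<tau> \<Longrightarrow> \<A> \<subseteq> \<tau> \<Longrightarrow> crisp_topology_generated X \<A> \<subseteq> \<tau>"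
  by (auto simp: crisp_topology_generated_def)

lemma soft_topology_generated_minimal:
  "soft_topology_on X E \<S> \<Longrightarrow> \<F> \<subseteq> \<S> \<Longrightarrow> soft_topology_generated X E \<F> \<subseteq> \<S>"
  by (auto simp: soft_topology_generated_def)

lemma soft_topology_on_single_set:
  assumes "crisp_topology_on X \<sigma>"
  shows "soft_topology_on X E (single_set_soft_topology X E \<sigma>)"
proof -
  from assms have sub: "\<sigma> \<subseteq> Pow X" and top: "X \<in> \<sigma>"
    and Int: "\<And>U V. U \<in> \<sigma> \<Longrightarrow> V \<in> \<sigma> \<Longrightarrow> U \<inter> V \<in> \<sigma>"
    and Union: "\<And>\<A>. \<A> \<subseteq> \<sigma> \<Longrightarrow> \<Union>\<A> \<in> \<sigma>"
    by (auto simp: crisp_topology_on_iff)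
  \<comment> \<open>Its constant map is the null soft set.\<close>
  have "{} \<in> \<sigma>"
    using Union[of "{}"] by simp
  moreover have "single_set_soft_topology X E \<sigma> \<subseteq> soft_sets X E"
    by (auto simp: single_set_soft_topology_def)
  \<comment> \<open>A family of such constant maps is the image of some subfamily of
    \<open>\<sigma>\<close>, and its soft union is the constant map of the union of that
    subfamily.\<close>
  moreover have "soft_Union E \<G> \<in> (\<lambda>U. \<lambda>e\<in>E. U) ` \<sigma>" if "\<G> \<subseteq> (\<lambda>U. \<lambda>e\<in>E. U) ` \<sigma>" for \<G>
    using that Union by (auto simp: subset_image_iff soft_Union_const)
  ultimately show ?thesis
    using top Int
    unfolding soft_topology_on_def single_set_soft_topology_eq_image[OF sub]
    by (auto simp: null_soft_def absolute_soft_def soft_Int_const)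
qed

text \<open>The axioms of \<open>\<S>\<close>, applied to constant maps, pull back to the axioms of
  a crisp topology. The restriction to \<open>Pow X\<close> matters for empty \<open>E\<close>:
  there all constant maps coincide, so membership in \<open>\<S>\<close> says nothing about
  \<open>U\<close>.\<close>

lemma crisp_topology_on_const_preimage:
  assumes "soft_topology_on X E \<S>"
  shows "crisp_topology_on X {U \<in> Pow X. (\<lambda>e\<in>E. U) \<in> \<S>}"
  unfolding crisp_topology_on_iff
proof (intro conjI ballI allI impI)
  show "X \<in> {U \<in> Pow X. (\<lambda>e\<in>E. U) \<in> \<S>}"
    using assms by (simp add: soft_topology_on_def absolute_soft_def)
next
  fix U V
  assume "U \<in> {U \<in> Pow X. (\<lambda>e\<in>E. U) \<in> \<S>}" "V \<in> {U \<in> Pow X. (\<lambda>e\<in>E. U) \<in> \<S>}"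
  moreover from this have "soft_Int E (\<lambda>e\<in>E. U) (\<lambda>e\<in>E. V) \<in> \<S>"
    using assms by (simp add: soft_topology_on_def)
  ultimately show "U \<inter> V \<in> {U \<in> Pow X. (\<lambda>e\<in>E. U) \<in> \<S>}"
    by (auto simp: soft_Int_const)
next
  fix \<A> assume \<A>: "\<A> \<subseteq> {U \<in> Pow X. (\<lambda>e\<in>E. U) \<in> \<S>}"
  then have "(\<lambda>U. \<lambda>e\<in>E. U) ` \<A> \<subseteq> \<S>"
    by blast
  then have "soft_Union E ((\<lambda>U. \<lambda>e\<in>E. U) ` \<A>) \<in> \<S>"
    using assms by (simp add: soft_topology_on_def)
  with \<A> show "\<Union>\<A> \<in> {U \<in> Pow X. (\<lambda>e\<in>E. U) \<in> \<S>}"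
    by (auto simp: soft_Union_const)
qed auto

theorem lemma3p6:
  fixes X :: "'a set" and E :: "'e set" and \<Sigma> :: "'e \<Rightarrow> 'a set set"
  assumes "\<And>e. e \<in> E \<Longrightarrow> crisp_topology_on X (\<Sigma> e)"
  shows "soft_topology_generated X E (\<Union>e\<in>E. single_set_soft_topology X E (\<Sigma> e)) =
         single_set_soft_topology X E (crisp_topology_generated X (\<Union>e\<in>E. \<Sigma> e))"
proof
  let ?\<tau> = "crisp_topology_generated X (\<Union>e\<in>E. \<Sigma> e)"
  have \<Sigma>: "\<Sigma> e \<subseteq> Pow X" if "e \<in> E" for e
    using assms[OF that] by (simp add: crisp_topology_on_def)
  then have \<tau>: "crisp_topology_on X ?\<tau>"
    by (intro crisp_topology_on_generated UN_least)
  \<comment> \<open>This makes the right side a soft topology containing all the generators of the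
    left side.\<close>
  have "single_set_soft_topology X E (\<Sigma> e) \<subseteq> single_set_soft_topology X E ?\<tau>" if "e \<in> E" for e
    using that subset_crisp_topology_generated[of "\<Union>e\<in>E. \<Sigma> e" X]
    by (intro single_set_soft_topology_mono) blast
  then show "soft_topology_generated X E (\<Union>e\<in>E. single_set_soft_topology X E (\<Sigma> e))
      \<subseteq> single_set_soft_topology X E ?\<tau>"
    by (intro soft_topology_generated_minimal soft_topology_on_single_set \<tau> UN_least)
  show "single_set_soft_topology X E ?\<tau>
      \<subseteq> soft_topology_generated X E (\<Union>e\<in>E. single_set_soft_topology X E (\<Sigma> e))"
    \<comment> \<open>The target is an intersection, so it suffices to treat one arbitrary soft
      topology \<open>\<S>\<close> containing the generators.\<close>
    unfolding soft_topology_generated_def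
  proof (rule Inf_greatest)
    fix \<S>
    assume "\<S> \<in> {\<S>. soft_topology_on X E \<S> \<and>
                    (\<Union>e\<in>E. single_set_soft_topology X E (\<Sigma> e)) \<subseteq> \<S>}"
    then have \<S>: "soft_topology_on X E \<S>"
      and sub: "\<And>e. e \<in> E \<Longrightarrow> single_set_soft_topology X E (\<Sigma> e) \<subseteq> \<S>"
      by (simp_all add: UN_subset_iff)
    \<comment> \<open>The pullback of \<open>\<S>\<close> along constants is a crisp topology; once
      it contains every \<open>\<Sigma> e\<close>, minimality puts \<open>?\<tau>\<close> inside
      it.\<close>
    have "\<Sigma> e \<subseteq> {U \<in> Pow X. (\<lambda>e\<in>E. U) \<in> \<S>}" if "e \<in> E" for e
      using sub[OF that] \<Sigma>[OF that]
      by (simp add: single_set_soft_topology_eq_image image_subset_iff subset_iff)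
    then have "?\<tau> \<subseteq> {U \<in> Pow X. (\<lambda>e\<in>E. U) \<in> \<S>}"
      by (intro crisp_topology_generated_minimal crisp_topology_on_const_preimage \<S> UN_least)
    \<comment> \<open>Pushing forward again, these constant maps are exactly the members of the
      single set soft topology of \<open>?\<tau>\<close>.\<close>
    then have "(\<lambda>U. \<lambda>e\<in>E. U) ` ?\<tau> \<subseteq> \<S>"
      by auto
    then show "single_set_soft_topology X E ?\<tau> \<subseteq> \<S>"
      using \<tau> by (simp add: single_set_soft_topology_eq_image crisp_topology_on_def)
  qed
qed

end
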